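(* Let $A=[a_{ij}]\in\mathbb{R}^{n\times n}$ ($n\ge 1$) be a real matrix whose characteristic polynomial $p(x)=\det(xI-A)\in\mathbb{R}[x]$ is square-free. For $i=1,\dots,n$ let $R_i=\sum_{j\ne i}|a_{ij}|$, let $D_i=\{z\in\mathbb{C}: |z-a_{ii}|\le R_i\}$ be the $i$-th Gershgorin disk of $A$, and let $q_i(x)=(x-a_{ii})^2-R_i^2\in\mathbb{R}[x]$. Then for every $i\in\{1,\dots,n\}$: if $$\sigma(H_{q_i}(p))=\sigma(H_1(p)),$$ then $A$ has no real eigenvalue in $D_i$.
   Context: A polynomial $p\in\mathbb{R}[x]$ is square-free if $\gcd(p,p')=1$. For a square-free polynomial $p\in\mathbb{R}[x]$ of degree $n\ge 1$ with (distinct) complex roots $z_1,\dots,z_n$ and for $q\in\mathbb{R}[x]$, the Hermite matrix of $p$ with respect to $q$ is the $n\times n$ matrix $H_q(p)=V^T D_q V$, where $V=[z_i^{\,j-1}]_{i,j=1}^n$ is the Vandermonde matrix and $D_q=\mathrm{diag}(q(z_1),\dots,q(z_n))$; equivalently $[H_q(p)]_{i,j}=\sum_{k=1}^n z_k^{\,i+j-2}q(z_k)$. It is a real symmetric matrix. $H_1(p)$ denotes the case of the constant polynomial $q=1$. The signature $\sigma(S)$ of a real symmetric matrix $S$ is the number of positive eigenvalues minus the number of negative eigenvalues of $S$, counted with multiplicity. *)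

theory Defs
  imports
    "Jordan_Normal_Form.Char_Poly"
    "HOL-Computational_Algebra.Polynomial_Factorial"
    "HOL-Computational_Algebra.Field_as_Ring"
    "HOL-Computational_Algebra.Fundamental_Theorem_Algebra"
begin

definition square_free_poly :: "real poly \<Rightarrow> bool" where
  "square_free_poly p \<longleftrightarrow> gcd p (pderiv p) = 1"

definition complex_root_set :: "real poly \<Rightarrow> complex set" where
  "complex_root_set p = {z. poly (map_poly complex_of_real p) z = 0}"

(* A fixed enumeration of the distinct complex roots (for p nonzero). The Hermite matrix
   does not depend on it, see hermite_of_enum_entry. *)
definition root_enum :: "real poly \<Rightarrow> complex list" where
  "root_enum p = (SOME zs. distinct zs \<and> set zs = complex_root_set p)"

lemma root_enum:
  assumes "p \<noteq> 0"
  shows "distinct (root_enum p)" "set (root_enum p) = complex_root_set p"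
proof -
  have "map_poly complex_of_real p \<noteq> 0"
    using assms by simp
  then have "finite (complex_root_set p)"
    unfolding complex_root_set_def by (rule poly_roots_finite)
  then have "\<exists>zs. distinct zs \<and> set zs = complex_root_set p"
    using finite_distinct_list by blast
  then have "distinct (root_enum p) \<and> set (root_enum p) = complex_root_set p"
    unfolding root_enum_def by (rule someI_ex)
  then show "distinct (root_enum p)" "set (root_enum p) = complex_root_set p"
    by auto
qed

lemma length_root_enum:
  assumes "p \<noteq> 0" and "square_free_poly p"
  shows "length (root_enum p) = degree p"
proof -
  let ?P = "map_poly complex_of_real p"
  obtain u v where uv: "u * p + v * pderiv p = 1"
    using assms(2) bezout_coefficients_fst_snd[of p "pderiv p"]
    unfolding square_free_poly_def by metis
  have mult: "map_poly complex_of_real (r * s) =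
      map_poly complex_of_real r * map_poly complex_of_real s" for r s
    by (rule poly_eqI) (simp add: coeff_mult coeff_map_poly)
  have "map_poly complex_of_real (u * p + v * pderiv p) = 1"
    unfolding uv by simp
  then have *: "map_poly complex_of_real u * ?P + map_poly complex_of_real v * pderiv ?P = 1"
    by (simp only: of_real_hom.map_poly_hom_add mult of_real_hom.map_poly_pderiv)
  have "rsquarefree ?P"
    unfolding rsquarefree_roots
  proof (intro allI notI)
    fix a assume "poly ?P a = 0 \<and> poly (pderiv ?P) a = 0"
    then show False
      using arg_cong[OF *, of "\<lambda>r. poly r a"] by simp
  qed
  then have dec: "Polynomial.smult (lead_coeff ?P) (\<Prod>z \<in> complex_root_set p. [:-z, 1:]) = ?P"
    unfolding complex_root_set_def by (rule complex_poly_decompose_rsquarefree)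
  have "degree ?P = degree (Polynomial.smult (lead_coeff ?P) (\<Prod>z \<in> complex_root_set p. [:-z, 1:]))"
    using dec by (rule arg_cong[OF sym])
  also have "\<dots> = degree (\<Prod>z \<in> complex_root_set p. [:-z, 1:])"
    using assms(1) by (intro degree_smult_eq[THEN trans]) simp
  also have "\<dots> = (\<Sum>z \<in> complex_root_set p. degree [:-z, 1:])"
    by (rule degree_prod_eq_sum_degree) simp
  also have "\<dots> = card (complex_root_set p)"
    by simp
  also have "card (complex_root_set p) = length (root_enum p)"
    using root_enum[OF assms(1)] distinct_card by metis
  finally show ?thesis
    by (simp only: of_real_hom.degree_map_poly_hom)
qed

(* Indices start at 0, so the (i, j) entry is z_i ^ j rather than z_i ^ (j - 1). *)
definition vandermonde_mat :: "complex list \<Rightarrow> complex mat" where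
  "vandermonde_mat zs = mat (length zs) (length zs) (\<lambda>(i, j). (zs ! i) ^ j)"

definition hermite_of_enum :: "complex list \<Rightarrow> real poly \<Rightarrow> complex mat" where
  "hermite_of_enum zs q =
     transpose_mat (vandermonde_mat zs)
     * mat_diag (length zs) (\<lambda>k. poly (map_poly complex_of_real q) (zs ! k))
     * vandermonde_mat zs"

(* hermite_mat q p is H_q(p). Taking real parts only changes the type: the matrix
   already has real entries, see of_real_hermite_mat. *)
definition hermite_mat :: "real poly \<Rightarrow> real poly \<Rightarrow> real mat" where
  "hermite_mat q p = map_mat Re (hermite_of_enum (root_enum p) q)"

lemma hermite_of_enum_dim [simp]:
  "dim_row (hermite_of_enum zs q) = length zs"
  "dim_col (hermite_of_enum zs q) = length zs"
  by (simp_all add: hermite_of_enum_def vandermonde_mat_def)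

lemma hermite_of_enum_entry:
  assumes "distinct zs" "i < length zs" "j < length zs"
  shows "hermite_of_enum zs q $$ (i, j) =
           (\<Sum>z \<in> set zs. z ^ (i + j) * poly (map_poly complex_of_real q) z)"
proof -
  have "hermite_of_enum zs q $$ (i, j) =
      (\<Sum>k<length zs. (zs!k) ^ (i + j) * poly (map_poly complex_of_real q) (zs!k))"
    unfolding hermite_of_enum_def using assms(2,3)
    by (subst mat_diag_mult_right[of _ "length zs"])
       (auto simp: vandermonde_mat_def scalar_prod_def power_add atLeast0LessThan intro!: sum.cong)
  also have "\<dots> = (\<Sum>z \<in> set zs. z ^ (i + j) * poly (map_poly complex_of_real q) z)"
    using sum.reindex_bij_betw[OF bij_betw_nth[OF assms(1) refl refl], of "\<lambda>z. z ^ (i + j) * poly (map_poly complex_of_real q) z"] by simp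
  finally show ?thesis .
qed

lemma poly_of_real_cnj:
  "poly (map_poly complex_of_real q) (cnj z) = cnj (poly (map_poly complex_of_real q) z)"
  by (rule poly_cnj_real [symmetric]) (simp add: coeff_map_poly)

lemma of_real_hermite_mat:
  assumes "p \<noteq> 0"
  shows "map_mat complex_of_real (hermite_mat q p) = hermite_of_enum (root_enum p) q"
proof (rule eq_matI)
  let ?zs = "root_enum p" and ?f = "\<lambda>k z. z ^ k * poly (map_poly complex_of_real q) z"
  have closed: "cnj z \<in> set ?zs" if "z \<in> set ?zs" for z
    using that unfolding root_enum(2)[OF assms] complex_root_set_def mem_Collect_eq poly_of_real_cnj
    by (simp only: complex_cnj_zero)
  have img: "cnj ` set ?zs = set ?zs"
  proof (intro equalityI subsetI)
    fix z assume "z \<in> cnj ` set ?zs"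
    then show "z \<in> set ?zs"
      using closed by blast
  next
    fix z assume "z \<in> set ?zs"
    then show "z \<in> cnj ` set ?zs"
      using closed by (metis complex_cnj_cnj image_eqI)
  qed
  fix i j assume "i < dim_row (hermite_of_enum ?zs q)" "j < dim_col (hermite_of_enum ?zs q)"
  then have ij: "i < length ?zs" "j < length ?zs"
    by simp_all
  have "cnj (\<Sum>z \<in> set ?zs. ?f (i + j) z) = (\<Sum>z \<in> set ?zs. ?f (i + j) (cnj z))"
    by (simp only: cnj_sum complex_cnj_mult complex_cnj_power poly_of_real_cnj)
  also have "\<dots> = (\<Sum>z \<in> cnj ` set ?zs. ?f (i + j) z)"
    by (subst sum.reindex) (auto simp: inj_on_def)
  finally have "cnj (hermite_of_enum ?zs q $$ (i, j)) = hermite_of_enum ?zs q $$ (i, j)"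
    by (simp only: img hermite_of_enum_entry[OF root_enum(1)[OF assms] ij])
  then have "complex_of_real (Re (hermite_of_enum ?zs q $$ (i, j))) = hermite_of_enum ?zs q $$ (i, j)"
    by (metis Reals_cnj_iff of_real_Re)
  then show "map_mat complex_of_real (hermite_mat q p) $$ (i, j) = hermite_of_enum ?zs q $$ (i, j)"
    using ij by (simp add: hermite_mat_def)
qed (simp_all add: hermite_mat_def)

lemma hermite_mat_symmetric:
  assumes "p \<noteq> 0"
  shows "transpose_mat (hermite_mat q p) = hermite_mat q p"
proof (rule eq_matI)
  fix i j assume "i < dim_row (hermite_mat q p)" "j < dim_col (hermite_mat q p)"
  then show "transpose_mat (hermite_mat q p) $$ (i, j) = hermite_mat q p $$ (i, j)"
    using root_enum(1)[OF assms]
    by (simp add: hermite_mat_def hermite_of_enum_entry add.commute)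
qed (simp_all add: hermite_mat_def)

(* Meant for symmetric S: all roots of the characteristic polynomial are then real,
   and order x (char_poly S) is the multiplicity of the eigenvalue x. *)
definition signature :: "real mat \<Rightarrow> int" where
  "signature S =
     (\<Sum>x \<in> {x. eigenvalue S x \<and> x > 0}. int (order x (char_poly S)))
     - (\<Sum>x \<in> {x. eigenvalue S x \<and> x < 0}. int (order x (char_poly S)))"

definition gershgorin_radius :: "real mat \<Rightarrow> nat \<Rightarrow> real" where
  "gershgorin_radius A i = (\<Sum>j \<in> {..<dim_col A} - {i}. \<bar>A $$ (i, j)\<bar>)"

definition gershgorin_disk :: "real mat \<Rightarrow> nat \<Rightarrow> complex set" where
  "gershgorin_disk A i =
     {z. cmod (z - complex_of_real (A $$ (i, i))) \<le> gershgorin_radius A i}"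

definition gershgorin_poly :: "real mat \<Rightarrow> nat \<Rightarrow> real poly" where
  "gershgorin_poly A i = ([:0, 1:] - [:A $$ (i, i):]) ^ 2 - [:(gershgorin_radius A i) ^ 2:]"

end

theory Submission
  imports Defs "Jordan_Normal_Form.Schur_Decomposition"
begin

text \<open>For a real vector \<open>x\<close> let \<open>f\<close> be the polynomial with coefficients \<open>x\<close>. Then
  \<open>x \<bullet> (H\<^sub>q(p) x)\<close> is the sum of \<open>q z * (f z)\<^sup>2\<close> over the roots \<open>z\<close> of \<open>p\<close>. A real root
  contributes \<open>q z\<close> times a real square, and a pair of conjugate nonreal roots contributes either one
  positive and one negative square or nothing. These linear forms are independent because \<open>f\<close>
  has degree below the number of roots, so Sylvester's law of inertia (together with the spectral
  theorem) gives Hermite's theorem: the signature of \<open>H\<^sub>q(p)\<close> is the sum of the signs of \<open>q\<close> over the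
  real roots of \<open>p\<close>. For \<open>q = 1\<close> this counts the real roots, so equality of the signatures forces
  \<open>q > 0\<close> at every real root, whereas \<open>q\<^sub>i \<le> 0\<close> at a real point of the \<open>i\<close>-th Gershgorin
  disk.\<close>

section \<open>Sylvester's law of inertia for weighted sums of squares\<close>

text \<open>Fewer than \<open>n\<close> vectors, padded with zero rows, form a singular square
  matrix, and any nonzero kernel vector of it is orthogonal to all of them.\<close>

lemma ex_nonzero_orthogonal_vec:
  fixes R :: "'a::field vec set"
  assumes "finite R" "R \<subseteq> carrier_vec n" "card R < n"
  shows "\<exists>x \<in> carrier_vec n. x \<noteq> 0\<^sub>v n \<and> (\<forall>r \<in> R. r \<bullet> x = 0)"
proof -
  obtain rs where rs: "set rs = R" "length rs = card R"
    using assms(1) by (metis finite_distinct_list distinct_card)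
  define c where "c i = (if i < card R then rs ! i else 0\<^sub>v n)" for i
  have c: "c i \<in> carrier_vec n" for i
    using assms(2) rs by (auto simp: c_def)
  \<comment> \<open>Row \<open>card R\<close>, the first padding row, is written out as zero to give
    the matrix the shape that \<open>det_row_0\<close> expects.\<close>
  define M where "M = mat\<^sub>r n n (\<lambda>i. if i = card R then 0\<^sub>v n else c i)"
  have M: "M \<in> carrier_mat n n"
    by (simp add: M_def)
  have "det M = 0"
    unfolding M_def using assms(3) c by (intro det_row_0) auto
  then obtain x where x: "x \<in> carrier_vec n" "x \<noteq> 0\<^sub>v n" "M *\<^sub>v x = 0\<^sub>v n"
    using det_0_iff_vec_prod_zero[OF M] by blast
  have "r \<bullet> x = 0" if "r \<in> R" for r
  proof -
    have "r \<in> set rs"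
      using that rs(1) by simp
    then obtain i where i: "i < card R" "r = rs ! i"
      unfolding in_set_conv_nth rs(2) by blast
    have "row M i = r"
      using i assms(3) c[of i] by (simp add: M_def c_def)
    moreover have "(M *\<^sub>v x) $ i = row M i \<bullet> x"
      using M i(1) assms(3) by simp
    ultimately show ?thesis
      using x(3) i(1) assms(3) by simp
  qed
  with x show ?thesis
    by blast
qed

text \<open>Otherwise fewer than \<open>n\<close> linear conditions make all negative terms on the left and all
  positive terms on the right vanish.\<close>

lemma card_pos_le_of_quadratic_form_eq:
  fixes g :: "'i \<Rightarrow> real vec" and h :: "'j \<Rightarrow> real vec"
  assumes fin: "finite I" "finite J" and card: "card I = n"
    and g: "\<And>i. i \<in> I \<Longrightarrow> g i \<in> carrier_vec n" and h: "\<And>j. j \<in> J \<Longrightarrow> h j \<in> carrier_vec n"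
    and form: "\<And>x. x \<in> carrier_vec n \<Longrightarrow>
      (\<Sum>i \<in> I. d i * (g i \<bullet> x)\<^sup>2) = (\<Sum>j \<in> J. l j * (h j \<bullet> x)\<^sup>2)"
    and inj: "\<And>x. x \<in> carrier_vec n \<Longrightarrow> (\<And>i. i \<in> I \<Longrightarrow> g i \<bullet> x = 0) \<Longrightarrow> x = 0\<^sub>v n"
  shows "card {i \<in> I. d i > 0} \<le> card {j \<in> J. l j > 0}"
proof (rule ccontr)
  assume less: "\<not> ?thesis"
  define R where "R = g ` {i \<in> I. d i \<le> 0} \<union> h ` {j \<in> J. l j > 0}"
  have R: "finite R" "R \<subseteq> carrier_vec n"
    using fin g h by (auto simp: R_def)
  have split: "card {i \<in> I. d i \<le> 0} + card {i \<in> I. d i > 0} = n"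
    using fin(1) card by (subst card_Un_disjoint[symmetric]) (auto intro!: arg_cong[of _ _ card])
  have "card R \<le> card {i \<in> I. d i \<le> 0} + card {j \<in> J. l j > 0}"
    unfolding R_def using fin by (intro card_Un_le[THEN order_trans] add_mono card_image_le) auto
  also have "\<dots> < n"
    using less split by linarith
  finally obtain x where x: "x \<in> carrier_vec n" "x \<noteq> 0\<^sub>v n" "\<forall>r \<in> R. r \<bullet> x = 0"
    using ex_nonzero_orthogonal_vec[OF R] by blast
  have nonneg: "d i * (g i \<bullet> x)\<^sup>2 \<ge> 0" if "i \<in> I" for i
    using that x(3) by (cases "d i \<le> 0") (auto simp: R_def)
  have "l j * (h j \<bullet> x)\<^sup>2 \<le> 0" if "j \<in> J" for j
    using that x(3) by (cases "l j > 0") (auto simp: R_def mult_le_0_iff)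
  then have "(\<Sum>i \<in> I. d i * (g i \<bullet> x)\<^sup>2) \<le> 0"
    unfolding form[OF x(1)] by (rule sum_nonpos)
  \<comment> \<open>The common value of both sums is now at least and at most 0, so each nonnegative
    term on the left vanishes. Indices with \<open>d i > 0\<close> thus satisfy
    \<open>g i \<bullet> x = 0\<close>; the other \<open>g i\<close> lie in
    \<open>R\<close>.\<close>
  then have zero: "d i * (g i \<bullet> x)\<^sup>2 = 0" if "i \<in> I" for i
    using sum_nonneg_eq_0_iff[OF fin(1), of "\<lambda>i. d i * (g i \<bullet> x)\<^sup>2"] sum_nonneg[of I "\<lambda>i. d i * (g i \<bullet> x)\<^sup>2"] nonneg that
    by force
  have "g i \<bullet> x = 0" if "i \<in> I" for i
    using zero[OF that] x(3) that by (cases "d i \<le> 0") (auto simp: R_def)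
  with inj x show False
    by blast
qed

text \<open>The one-sided estimate is applied in both directions, first to the given weights and
  then to their negatives.\<close>

lemma sylvester_inertia:
  fixes g :: "'i \<Rightarrow> real vec" and h :: "'j \<Rightarrow> real vec"
  assumes "finite I" "finite J" and "card I = n" "card J = n"
    and "\<And>i. i \<in> I \<Longrightarrow> g i \<in> carrier_vec n" and "\<And>j. j \<in> J \<Longrightarrow> h j \<in> carrier_vec n"
    and form: "\<And>x. x \<in> carrier_vec n \<Longrightarrow>
      (\<Sum>i \<in> I. d i * (g i \<bullet> x)\<^sup>2) = (\<Sum>j \<in> J. l j * (h j \<bullet> x)\<^sup>2)"
    and "\<And>x. x \<in> carrier_vec n \<Longrightarrow> (\<And>i. i \<in> I \<Longrightarrow> g i \<bullet> x = 0) \<Longrightarrow> x = 0\<^sub>v n"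
    and "\<And>x. x \<in> carrier_vec n \<Longrightarrow> (\<And>j. j \<in> J \<Longrightarrow> h j \<bullet> x = 0) \<Longrightarrow> x = 0\<^sub>v n"
  shows "card {i \<in> I. d i > 0} = card {j \<in> J. l j > 0}"
    and "card {i \<in> I. d i < 0} = card {j \<in> J. l j < 0}"
proof -
  show "card {i \<in> I. d i > 0} = card {j \<in> J. l j > 0}"
    using assms by (intro antisym card_pos_le_of_quadratic_form_eq[where g = g and h = h and n = n]
        card_pos_le_of_quadratic_form_eq[where g = h and h = g and n = n]) auto
  have neg: "(\<Sum>i \<in> I. - d i * (g i \<bullet> x)\<^sup>2) = (\<Sum>j \<in> J. - l j * (h j \<bullet> x)\<^sup>2)"
    if "x \<in> carrier_vec n" for x
    using form[OF that] by (simp add: sum_negf)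
  have "card {i \<in> I. - d i > 0} = card {j \<in> J. - l j > 0}"
    using assms neg by (intro antisym card_pos_le_of_quadratic_form_eq[where g = g and h = h and n = n]
        card_pos_le_of_quadratic_form_eq[where g = h and h = g and n = n]) auto
  then show "card {i \<in> I. d i < 0} = card {j \<in> J. l j < 0}"
    by simp
qed

section \<open>The spectral theorem for real symmetric matrices\<close>

text \<open>The fundamental theorem of algebra supplies a complex eigenvalue \<open>z\<close>. Since
  the matrix is Hermitian over the complex numbers, moving it across the inner product of an
  eigenvector with itself gives \<open>z = cnj z\<close>.\<close>

lemma real_symmetric_ex_eigenvalue:
  fixes S :: "real mat"
  assumes S: "S \<in> carrier_mat n n" and sym: "transpose_mat S = S" and n: "n > 0"
  shows "\<exists>e. eigenvalue S e"
proof -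
  let ?C = "map_mat complex_of_real S"
  have C: "?C \<in> carrier_mat n n"
    using S by simp
  have "\<not> constant (poly (char_poly ?C))"
    using degree_monic_char_poly[OF C] n by (simp add: constant_degree)
  then obtain z where z: "poly (char_poly ?C) z = 0"
    using fundamental_theorem_of_algebra by blast
  then have "eigenvalue ?C z"
    using eigenvalue_root_char_poly[OF C] by simp
  then obtain v where v: "v \<in> carrier_vec n" "v \<noteq> 0\<^sub>v n" "?C *\<^sub>v v = z \<cdot>\<^sub>v v"
    using C by (auto simp: eigenvalue_def eigenvector_def)
  have conj: "conjugate (?C *\<^sub>v v) = ?C *\<^sub>v conjugate v"
    using S v(1) by (intro eq_vecI) (auto simp: scalar_prod_def cnj_sum)
  have symC: "transpose_mat ?C = ?C"
    by (simp add: sym map_mat_transpose)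
  have "z * (v \<bullet>c v) = (?C *\<^sub>v v) \<bullet>c v"
    unfolding v(3) using v(1) by simp
  also have "\<dots> = v \<bullet>c (?C *\<^sub>v v)"
    unfolding conj using transpose_vec_mult_scalar[OF C, of "conjugate v" v] v(1) symC by simp
  also have "\<dots> = cnj z * (v \<bullet>c v)"
    unfolding v(3) using v(1) by (simp add: conjugate_smult_vec)
  finally have "z = cnj z"
    using conjugate_square_eq_0_vec[OF v(1)] v(2) by auto
  then have real: "z = complex_of_real (Re z)"
    by (metis Reals_cnj_iff of_real_Re)
  have "complex_of_real (poly (char_poly S) (Re z)) = 0"
    using z unfolding of_real_hom.char_poly_hom[OF S]
    by (metis of_real_hom.poly_map_poly real)
  then show ?thesis
    using eigenvalue_root_char_poly[OF S] by auto
qed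

text \<open>Gram-Schmidt applied to a basis that starts with \<open>v\<close> leaves
  \<open>v\<close> in first place. Normalizing the resulting vectors yields the columns, so
  \<open>c\<close> is the reciprocal of the length of \<open>v\<close>.\<close>

lemma ex_orthogonal_mat_with_first_col:
  fixes v :: "real vec"
  assumes v: "v \<in> carrier_vec n" "v \<noteq> 0\<^sub>v n"
  shows "\<exists>W \<in> carrier_mat n n. \<exists>c. transpose_mat W * W = 1\<^sub>m n \<and> col W 0 = c \<cdot>\<^sub>v v"
proof -
  interpret cof_vec_space n "TYPE(real)" .
  define ws where "ws = gram_schmidt n (basis_completion v)"
  note b = basis_completion[OF v]
  have ws: "set ws \<subseteq> carrier_vec n" "corthogonal ws" "length ws = n"
    using gram_schmidt_result[OF b(2,4,5) ws_def] b(6) by auto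
  have n: "n > 0"
    using v by (cases n) auto
  obtain vs where "basis_completion v = v # vs"
    using b(6,7) n by (cases "basis_completion v") auto
  then have hd: "ws ! 0 = v"
    unfolding ws_def using gram_schmidt_hd[OF v(1), of vs] ws(3) n ws_def
    by (metis hd_conv_nth length_0_conv less_numeral_extra(3))
  have orth: "ws ! i \<bullet> ws ! j = 0 \<longleftrightarrow> i \<noteq> j" if "i < n" "j < n" for i j
    using corthogonalD[OF ws(2)] that ws(3) by (auto simp: conjugate_vec_def)
  have car: "ws ! i \<in> carrier_vec n" if "i < n" for i
    using ws that by auto
  \<comment> \<open>The case \<open>i = j\<close> of \<open>orth\<close> says that the product is
    nonzero, and a sum of real squares is nonnegative.\<close>
  have pos: "ws ! i \<bullet> ws ! i > 0" if "i < n" for i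
    using orth[OF that that] by (simp add: order_less_le scalar_prod_def sum_nonneg)
  define W where "W = mat_of_cols n (map (\<lambda>w. (1 / sqrt (w \<bullet> w)) \<cdot>\<^sub>v w) ws)"
  have W: "W \<in> carrier_mat n n"
    using ws(3) by (auto simp: W_def)
  have col: "col W i = (1 / sqrt (ws ! i \<bullet> ws ! i)) \<cdot>\<^sub>v ws ! i" if "i < n" for i
    using that car[OF that] ws(3) by (auto simp: W_def)
  have "transpose_mat W * W = 1\<^sub>m n"
  proof (rule eq_matI)
    fix i j assume "i < dim_row (1\<^sub>m n :: real mat)" "j < dim_col (1\<^sub>m n :: real mat)"
    then have ij: "i < n" "j < n"
      by simp_all
    have "(transpose_mat W * W) $$ (i, j) = col W i \<bullet> col W j"
      using W ij by simp
    also have "\<dots> = 1 / sqrt (ws ! i \<bullet> ws ! i) * (1 / sqrt (ws ! j \<bullet> ws ! j) * (ws ! i \<bullet> ws ! j))"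
      using car[OF ij(1)] car[OF ij(2)] col ij
      by (simp add: smult_scalar_prod_distrib[of _ n] scalar_prod_smult_distrib[of _ n])
    also have "\<dots> = 1\<^sub>m n $$ (i, j)"
      using orth[OF ij] pos[OF ij(1)] ij by auto
    finally show "(transpose_mat W * W) $$ (i, j) = 1\<^sub>m n $$ (i, j)" .
  qed (use W in auto)
  then show ?thesis
    using W col[OF n] hd by auto
qed


text \<open>Deflation by induction on the dimension: in an orthonormal basis starting with an
  eigenvector, \<open>S\<close> splits into a 1 by 1 block and a symmetric block of size
  \<open>m\<close>, which the induction hypothesis diagonalizes.\<close>

lemma real_spectral_theorem:
  fixes S :: "real mat"
  assumes "S \<in> carrier_mat n n" and "transpose_mat S = S"
  shows "\<exists>P l. P \<in> carrier_mat n n \<and> transpose_mat P * P = 1\<^sub>m n \<and>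
    transpose_mat P * S * P = mat_diag n l"
  using assms
proof (induction n arbitrary: S)
  case 0
  then have "transpose_mat (1\<^sub>m 0) * (1\<^sub>m 0 :: real mat) = 1\<^sub>m 0"
    "transpose_mat (1\<^sub>m 0) * S * 1\<^sub>m 0 = mat_diag 0 (\<lambda>_. 0)"
    by (auto simp: mat_diag_def intro!: eq_matI)
  then show ?case
    using one_carrier_mat[of 0] by (intro exI[of _ "1\<^sub>m 0"] exI[of _ "\<lambda>_. 0"] conjI)
next
  case (Suc m)
  note S = Suc.prems(1) and sym = Suc.prems(2)
  let ?n = "Suc m"
  note assoc = assoc_mult_mat[of _ ?n ?n _ ?n _ ?n]
  obtain e where "eigenvalue S e"
    using real_symmetric_ex_eigenvalue[OF S sym] by auto
  then obtain v where v: "v \<in> carrier_vec ?n" "v \<noteq> 0\<^sub>v ?n" "S *\<^sub>v v = e \<cdot>\<^sub>v v"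
    using S by (auto simp: eigenvalue_def eigenvector_def)
  obtain W c where W: "W \<in> carrier_mat ?n ?n" "transpose_mat W * W = 1\<^sub>m ?n" "col W 0 = c \<cdot>\<^sub>v v"
    using ex_orthogonal_mat_with_first_col[OF v(1,2)] by blast
  define A where "A = transpose_mat W * S * W"
  have A: "A \<in> carrier_mat ?n ?n"
    using W S by (simp add: A_def)
  have "transpose_mat A = transpose_mat W * (transpose_mat S * transpose_mat (transpose_mat W))"
    unfolding A_def using W S by (simp add: transpose_mult[of _ ?n ?n _ ?n])
  then have "transpose_mat A = A"
    unfolding A_def using W S sym by (simp add: assoc)
  then have A_sym: "A $$ (i, j) = A $$ (j, i)" if "i < ?n" "j < ?n" for i j
    using A that by (metis carrier_matD index_transpose_mat(1))
  \<comment> \<open>The first column of \<open>W\<close> is a multiple of the eigenvector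
    \<open>v\<close>, and the columns of \<open>W\<close> are orthonormal.\<close>
  have A_col: "A $$ (i, 0) = (if i = 0 then e else 0)" if i: "i < ?n" for i
  proof -
    have "col (S * W) 0 = S *\<^sub>v col W 0"
      using col_mult2[OF S W(1)] by simp
    also have "\<dots> = e \<cdot>\<^sub>v col W 0"
      unfolding W(3) using v by (simp add: mult_mat_vec[OF S] smult_smult_assoc mult.commute)
    finally have "col (S * W) 0 = e \<cdot>\<^sub>v col W 0" .
    moreover have "A = transpose_mat W * (S * W)"
      unfolding A_def using S W by (simp add: assoc)
    ultimately have "A $$ (i, 0) = e * (col W i \<bullet> col W 0)"
      using i S W(1) by simp
    also have "col W i \<bullet> col W 0 = (transpose_mat W * W) $$ (i, 0)"
      using W(1) i by simp
    finally show ?thesis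
      unfolding W(2) using i by simp
  qed
  define B where "B = mat m m (\<lambda>(i, j). A $$ (Suc i, Suc j))"
  have B: "B \<in> carrier_mat m m" "transpose_mat B = B"
    using A_sym by (auto simp: B_def intro!: eq_matI)
  let ?E = "mat 1 1 (\<lambda>_. e)"
  \<comment> \<open>Symmetry carries the zeros of the first column over to the first row.\<close>
  have A_block: "A = four_block_mat ?E (0\<^sub>m 1 m) (0\<^sub>m m 1) B"
  proof (rule eq_matI)
    fix i j assume "i < dim_row (four_block_mat ?E (0\<^sub>m 1 m) (0\<^sub>m m 1) B)"
      "j < dim_col (four_block_mat ?E (0\<^sub>m 1 m) (0\<^sub>m m 1) B)"
    then have "i < ?n" "j < ?n"
      using B by auto
    then show "A $$ (i, j) = four_block_mat ?E (0\<^sub>m 1 m) (0\<^sub>m m 1) B $$ (i, j)"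
      using A_col[of i] A_col[of j] A_sym[of i j] B by (cases i; cases j) (auto simp: B_def)
  qed (use A B in auto)
  obtain Q l where Q: "Q \<in> carrier_mat m m" "transpose_mat Q * Q = 1\<^sub>m m"
    "transpose_mat Q * B * Q = mat_diag m l"
    using Suc.IH[OF B] by blast
  \<comment> \<open>\<open>F\<close> fixes the first coordinate and acts by \<open>Q\<close> on the
    rest; below, \<open>case_nat e l\<close> prepends \<open>e\<close> to the diagonal entries
    \<open>l\<close>.\<close>
  define F where "F = four_block_mat (1\<^sub>m 1) (0\<^sub>m 1 m) (0\<^sub>m m 1) Q"
  have F: "F \<in> carrier_mat ?n ?n"
    using Q by (auto simp: F_def)
  have FT: "transpose_mat F = four_block_mat (1\<^sub>m 1) (0\<^sub>m 1 m) (0\<^sub>m m 1) (transpose_mat Q)"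
    unfolding F_def using Q by (subst transpose_four_block_mat) auto
  have FF: "transpose_mat F * F = 1\<^sub>m ?n"
    unfolding FT unfolding F_def using Q
    by (subst mult_four_block_mat[of _ 1 1 _ m _ m _ _ 1 _ m]) (auto intro!: eq_matI)
  have FAF: "transpose_mat F * A * F = mat_diag ?n (case_nat e l)"
  proof -
    have "transpose_mat F * A = four_block_mat ?E (0\<^sub>m 1 m) (0\<^sub>m m 1) (transpose_mat Q * B)"
      unfolding FT A_block using Q B
      by (subst mult_four_block_mat[of _ 1 1 _ m _ m _ _ 1 _ m]) auto
    also have "\<dots> * F = four_block_mat ?E (0\<^sub>m 1 m) (0\<^sub>m m 1) (transpose_mat Q * B * Q)"
      unfolding F_def using Q B
      by (subst mult_four_block_mat[of _ 1 1 _ m _ m _ _ 1 _ m]) auto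
    also have "\<dots> = mat_diag ?n (case_nat e l)"
      unfolding Q(3) by (auto simp: mat_diag_def split: nat.split intro!: eq_matI)
    finally show ?thesis .
  qed
  define P where "P = W * F"
  have P: "P \<in> carrier_mat ?n ?n"
    using W F by (simp add: P_def)
  have PT: "transpose_mat P = transpose_mat F * transpose_mat W"
    unfolding P_def using W F by (simp add: transpose_mult[of _ ?n ?n _ ?n])
  have "transpose_mat P * P = transpose_mat F * (transpose_mat W * W) * F"
    unfolding PT unfolding P_def using W(1) F by (simp add: assoc)
  then have "transpose_mat P * P = 1\<^sub>m ?n"
    unfolding W(2) using F FF by simp
  moreover have "transpose_mat P * S * P = transpose_mat F * A * F"
    unfolding PT unfolding P_def A_def using W(1) F S by (simp add: assoc)
  ultimately show ?case
    using P FAF by auto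
qed

section \<open>The signature in terms of diagonalizations and sums of squares\<close>

lemma order_prod_linear:
  fixes l :: "'i \<Rightarrow> 'a::field"
  assumes "finite I"
  shows "Polynomial.order x (\<Prod>i \<in> I. [:- l i, 1:]) = card {i \<in> I. l i = x}"
  using assms
proof (induction I)
  case (insert i I)
  have "Polynomial.order x [:- l i, 1:] = (if l i = x then 1 else 0)"
    using order_power_n_n[of x 1] by (auto intro: order_0I)
  moreover have "{j \<in> insert i I. l j = x} = (if l i = x then insert i {j \<in> I. l j = x} else {j \<in> I. l j = x})"
    by auto
  moreover have "Polynomial.order x (\<Prod>j \<in> insert i I. [:- l j, 1:])
      = Polynomial.order x [:- l i, 1:] + Polynomial.order x (\<Prod>j \<in> I. [:- l j, 1:])"
    unfolding prod.insert[OF insert.hyps] by (rule order_mult) (simp add: insert.hyps del: mult_pCons_left)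
  ultimately show ?case
    using insert by simp
qed simp

lemma mat_diag_mult_vec_index:
  assumes "y \<in> carrier_vec n" "j < n"
  shows "(mat_diag n l *\<^sub>v y) $ j = l j * y $ j"
proof -
  have "(mat_diag n l *\<^sub>v y) $ j = (\<Sum>k<n. (if j = k then l k else 0) * y $ k)"
    using assms by (simp add: scalar_prod_def mat_diag_def atLeast0LessThan)
  also have "\<dots> = (\<Sum>k<n. if k = j then l j * y $ j else 0)"
    by (rule sum.cong) auto
  finally show ?thesis
    using assms(2) by simp
qed

text \<open>Both conclusions come from \<open>S = P * mat_diag n l * transpose_mat P\<close>:
  similarity gives the characteristic polynomial, and the substitution
  \<open>transpose_mat P *\<^sub>v x\<close> gives the quadratic form.\<close>

lemma
  fixes S :: "real mat"
  assumes S: "S \<in> carrier_mat n n" and P: "P \<in> carrier_mat n n"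
    and orth: "transpose_mat P * P = 1\<^sub>m n" and diag: "transpose_mat P * S * P = mat_diag n l"
  shows char_poly_of_orthogonal_diagonalization: "char_poly S = (\<Prod>j<n. [:- l j, 1:])"
    and quadratic_form_of_orthogonal_diagonalization:
      "x \<in> carrier_vec n \<Longrightarrow> x \<bullet> (S *\<^sub>v x) = (\<Sum>j<n. l j * (col P j \<bullet> x)\<^sup>2)"
proof -
  let ?D = "mat_diag n l"
  have D: "?D \<in> carrier_mat n n"
    by simp
  note assoc = assoc_mult_mat[of _ n n _ n _ n]
  have orth': "P * transpose_mat P = 1\<^sub>m n"
    using mat_mult_left_right_inverse[OF _ P orth] P by simp
  have "P * ?D * transpose_mat P = (P * transpose_mat P) * S * (P * transpose_mat P)"
    unfolding diag[symmetric] using S P by (simp add: assoc)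
  then have S_eq: "S = P * ?D * transpose_mat P"
    unfolding orth' using S by simp
  have "similar_mat S ?D"
    unfolding similar_mat_def using S P
    by (intro exI[of _ P] exI[of _ "transpose_mat P"] similar_mat_witI[OF orth' orth S_eq]) auto
  then have "char_poly S = char_poly ?D"
    by (rule char_poly_similar)
  also have "\<dots> = (\<Prod>a \<leftarrow> diag_mat ?D. [:- a, 1:])"
    by (rule char_poly_upper_triangular[OF D]) (auto simp: mat_diag_def)
  also have "\<dots> = (\<Prod>j<n. [:- l j, 1:])"
    by (simp add: diag_mat_def mat_diag_def prod.list_conv_set_nth atLeast0LessThan)
  finally show "char_poly S = (\<Prod>j<n. [:- l j, 1:])" .
  assume x: "x \<in> carrier_vec n"
  let ?y = "transpose_mat P *\<^sub>v x"
  have y: "?y \<in> carrier_vec n"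
    using P x by (intro mult_mat_vec_carrier[of _ n n]) simp_all
  have "x \<bullet> (S *\<^sub>v x) = x \<bullet> (P *\<^sub>v (?D *\<^sub>v ?y))"
    unfolding S_eq using P x by (simp add: assoc_mult_mat_vec[of _ n n _ n])
  also have "\<dots> = ?y \<bullet> (?D *\<^sub>v ?y)"
    using transpose_vec_mult_scalar[OF P, of "?D *\<^sub>v ?y" x] x y
    by (metis D mult_mat_vec_carrier)
  also have "\<dots> = (\<Sum>j<n. ?y $ j * (?D *\<^sub>v ?y) $ j)"
    unfolding scalar_prod_def using carrier_vecD[OF mult_mat_vec_carrier[OF D y]] by (simp only: atLeast0LessThan)
  also have "\<dots> = (\<Sum>j<n. l j * (col P j \<bullet> x)\<^sup>2)"
  proof (rule sum.cong)
    fix j assume "j \<in> {..<n}"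
    then have j: "j < n"
      by simp
    have "(?D *\<^sub>v ?y) $ j = l j * ?y $ j"
      by (rule mat_diag_mult_vec_index[OF y j])
    then show "?y $ j * (?D *\<^sub>v ?y) $ j = l j * (col P j \<bullet> x)\<^sup>2"
      using P j by (simp add: power2_eq_square)
  qed simp
  finally show "x \<bullet> (S *\<^sub>v x) = (\<Sum>j<n. l j * (col P j \<bullet> x)\<^sup>2)" .
qed

lemma signature_of_char_poly_linear_factors:
  assumes S: "S \<in> carrier_mat n n" and cp: "char_poly S = (\<Prod>j<n. [:- l j, 1:])"
  shows "signature S = int (card {j. j < n \<and> l j > 0}) - int (card {j. j < n \<and> l j < 0})"
proof -
  have ev: "eigenvalue S x \<longleftrightarrow> x \<in> l ` {..<n}" for x
    unfolding eigenvalue_root_char_poly[OF S] cp by (auto simp: poly_prod)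
  have count: "(\<Sum>x \<in> {x. eigenvalue S x \<and> Q x}. int (Polynomial.order x (char_poly S)))
      = int (card {j. j < n \<and> Q (l j)})" for Q
  proof -
    have "(\<Sum>x \<in> {x. eigenvalue S x \<and> Q x}. int (Polynomial.order x (char_poly S)))
        = (\<Sum>x \<in> l ` {j \<in> {..<n}. Q (l j)}. int (card {j \<in> {..<n}. l j = x}))"
      unfolding cp ev by (rule sum.cong) (auto simp: order_prod_linear)
    \<comment> \<open>The multiplicity of \<open>x\<close> is the size of its fibre under
      \<open>l\<close>; \<open>Q x\<close> holds here, so the fibre lies in the selected index set
      and \<open>sum.group\<close> applies.\<close>
    also have "\<dots> = (\<Sum>x \<in> l ` {j \<in> {..<n}. Q (l j)}. \<Sum>j | j \<in> {j \<in> {..<n}. Q (l j)} \<and> l j = x. 1)"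
      by (intro sum.cong) (auto intro!: arg_cong[of _ _ card])
    also have "\<dots> = int (card {j \<in> {..<n}. Q (l j)})"
      by (subst sum.group) auto
    finally show ?thesis
      by (simp add: lessThan_def)
  qed
  show ?thesis
    unfolding signature_def using count[of "\<lambda>x. x > 0"] count[of "\<lambda>x. x < 0"] by simp
qed

text \<open>An orthogonal diagonalization writes the same form with eigenvalues as weights, so
  inertia transfers its sign counts to any other representation by \<open>n\<close> independent
  linear forms.\<close>

lemma signature_eq_of_quadratic_form:
  fixes S :: "real mat" and g :: "'i \<Rightarrow> real vec"
  assumes S: "S \<in> carrier_mat n n" "transpose_mat S = S"
    and I: "finite I" "card I = n" and g: "\<And>i. i \<in> I \<Longrightarrow> g i \<in> carrier_vec n"
    and form: "\<And>x. x \<in> carrier_vec n \<Longrightarrow> x \<bullet> (S *\<^sub>v x) = (\<Sum>i \<in> I. d i * (g i \<bullet> x)\<^sup>2)"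
    and inj: "\<And>x. x \<in> carrier_vec n \<Longrightarrow> (\<And>i. i \<in> I \<Longrightarrow> g i \<bullet> x = 0) \<Longrightarrow> x = 0\<^sub>v n"
  shows "signature S = int (card {i \<in> I. d i > 0}) - int (card {i \<in> I. d i < 0})"
proof -
  obtain P l where P: "P \<in> carrier_mat n n" "transpose_mat P * P = 1\<^sub>m n"
    "transpose_mat P * S * P = mat_diag n l"
    using real_spectral_theorem[OF S] by blast
  have PPT: "P * transpose_mat P = 1\<^sub>m n"
    using mat_mult_left_right_inverse[OF _ P(1,2)] P(1) by simp
  \<comment> \<open>The columns of \<open>P\<close> are independent as linear forms because
    \<open>P\<close> is invertible.\<close>
  have inj': "x = 0\<^sub>v n" if x: "x \<in> carrier_vec n" and zero: "\<And>j. j \<in> {..<n} \<Longrightarrow> col P j \<bullet> x = 0" for x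
  proof -
    have "transpose_mat P *\<^sub>v x = 0\<^sub>v n"
      using zero P(1) by (intro eq_vecI) auto
    then have "P *\<^sub>v (transpose_mat P *\<^sub>v x) = 0\<^sub>v n"
      using P(1) by auto
    then show "x = 0\<^sub>v n"
      using P(1) PPT x by (simp flip: assoc_mult_mat_vec[of _ n n _ n])
  qed
  have form': "(\<Sum>i \<in> I. d i * (g i \<bullet> x)\<^sup>2) = (\<Sum>j<n. l j * (col P j \<bullet> x)\<^sup>2)"
    if "x \<in> carrier_vec n" for x
    using form[OF that] quadratic_form_of_orthogonal_diagonalization[OF S(1) P that] by simp
  have "card {i \<in> I. d i > 0} = card {j \<in> {..<n}. l j > 0}"
    "card {i \<in> I. d i < 0} = card {j \<in> {..<n}. l j < 0}"
    by (rule sylvester_inertia[where g = g and h = "col P" and n = n];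
        use I g form' inj inj' P(1) in auto)+
  then show ?thesis
    using signature_of_char_poly_linear_factors[OF S(1) char_poly_of_orthogonal_diagonalization[OF S(1) P]]
    by simp
qed

section \<open>Hermite's theorem on real roots\<close>

lemma cnj_complex_root_set_iff: "cnj z \<in> complex_root_set p \<longleftrightarrow> z \<in> complex_root_set p"
  by (simp add: complex_root_set_def poly_of_real_cnj del: of_real_hom.poly_map_poly)

lemma finite_complex_root_set: "p \<noteq> 0 \<Longrightarrow> finite (complex_root_set p)"
  using root_enum(2) by (metis List.finite_set)

lemma card_complex_root_set:
  assumes "p \<noteq> 0" "square_free_poly p"
  shows "card (complex_root_set p) = degree p"
  using root_enum[OF assms(1)] length_root_enum[OF assms] distinct_card by metis

text \<open>Nonreal roots of a real polynomial occur in conjugate pairs, each represented by its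
  member in the upper half plane.\<close>

lemma sum_complex_root_set:
  fixes F :: "complex \<Rightarrow> real"
  assumes "p \<noteq> 0"
  shows "(\<Sum>z \<in> complex_root_set p. F z) =
    (\<Sum>z | z \<in> complex_root_set p \<and> Im z = 0. F z) +
    (\<Sum>z | z \<in> complex_root_set p \<and> Im z > 0. F z + F (cnj z))"
proof -
  let ?Z = "complex_root_set p"
  let ?R = "{z \<in> ?Z. Im z = 0}" and ?U = "{z \<in> ?Z. Im z > 0}" and ?L = "{z \<in> ?Z. Im z < 0}"
  have fin: "finite ?Z"
    by (rule finite_complex_root_set[OF assms])
  have lower: "(\<Sum>z \<in> ?L. F z) = (\<Sum>z \<in> ?U. F (cnj z))"
    by (rule sum.reindex_bij_witness[of _ cnj cnj]) (auto simp: cnj_complex_root_set_iff)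
  have "?Z = ?R \<union> (?U \<union> ?L)"
    by auto
  then have "(\<Sum>z \<in> ?Z. F z) = (\<Sum>z \<in> ?R \<union> (?U \<union> ?L). F z)"
    by simp
  also have "\<dots> = (\<Sum>z \<in> ?R. F z) + ((\<Sum>z \<in> ?U. F z) + (\<Sum>z \<in> ?L. F z))"
    using fin by (subst sum.union_disjoint; (subst sum.union_disjoint)?) auto
  finally show ?thesis
    by (simp add: lower sum.distrib)
qed

text \<open>The plain square appears instead of a squared modulus because the Hermite matrix uses
  the transpose of the Vandermonde matrix without conjugation. This is why nonreal roots can
  contribute negative squares.\<close>

lemma hermite_mat_quadratic_form:
  assumes "p \<noteq> 0" and n: "n = length (root_enum p)" and x: "x \<in> carrier_vec n"
  shows "x \<bullet> (hermite_mat q p *\<^sub>v x) =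
    (\<Sum>z \<in> complex_root_set p.
      Re (poly (map_poly complex_of_real q) z * (\<Sum>j<n. complex_of_real (x $ j) * z ^ j)\<^sup>2))"
proof -
  let ?Z = "complex_root_set p" and ?Q = "poly (map_poly complex_of_real q)"
  let ?x = "\<lambda>j. complex_of_real (x $ j)"
  have entry: "hermite_mat q p $$ (i, j) = Re (\<Sum>z \<in> ?Z. z ^ (i + j) * ?Q z)" if "i < n" "j < n" for i j
    using that n hermite_of_enum_entry[OF root_enum(1)[OF assms(1)], of i j q] root_enum(2)[OF assms(1)]
    by (simp add: hermite_mat_def)
  have dim: "dim_row (hermite_mat q p) = n" "dim_col (hermite_mat q p) = n"
    by (simp_all add: hermite_mat_def n)
  have "x \<bullet> (hermite_mat q p *\<^sub>v x) = (\<Sum>i<n. x $ i * (\<Sum>j<n. hermite_mat q p $$ (i, j) * x $ j))"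
    using x dim by (simp add: scalar_prod_def atLeast0LessThan)
  also have "\<dots> = (\<Sum>i<n. \<Sum>j<n. x $ i * x $ j * Re (\<Sum>z \<in> ?Z. z ^ (i + j) * ?Q z))"
    using entry by (simp add: sum_distrib_left mult_ac)
  also have "\<dots> = (\<Sum>i<n. \<Sum>j<n. \<Sum>z \<in> ?Z. Re (?Q z * ((?x i * z ^ i) * (?x j * z ^ j))))"
  proof (intro sum.cong refl)
    fix i j
    have "x $ i * x $ j * Re (\<Sum>z \<in> ?Z. z ^ (i + j) * ?Q z)
        = Re (complex_of_real (x $ i * x $ j) * (\<Sum>z \<in> ?Z. z ^ (i + j) * ?Q z))"
      by simp
    also have "complex_of_real (x $ i * x $ j) * (\<Sum>z \<in> ?Z. z ^ (i + j) * ?Q z)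
        = (\<Sum>z \<in> ?Z. ?Q z * ((?x i * z ^ i) * (?x j * z ^ j)))"
      by (simp add: sum_distrib_left power_add mult_ac)
    finally show "x $ i * x $ j * Re (\<Sum>z \<in> ?Z. z ^ (i + j) * ?Q z)
        = (\<Sum>z \<in> ?Z. Re (?Q z * ((?x i * z ^ i) * (?x j * z ^ j))))"
      by simp
  qed
  also have "\<dots> = (\<Sum>z \<in> ?Z. \<Sum>i<n. \<Sum>j<n. Re (?Q z * ((?x i * z ^ i) * (?x j * z ^ j))))"
    by (subst (2) sum.swap, subst sum.swap) simp
  also have "\<dots> = (\<Sum>z \<in> ?Z. Re (?Q z * (\<Sum>j<n. ?x j * z ^ j)\<^sup>2))"
    unfolding power2_eq_square sum_product by (simp add: sum_distrib_left)
  finally show ?thesis .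
qed

text \<open>A nonzero polynomial of degree below \<open>n\<close> cannot vanish at \<open>n\<close>
  distinct points.\<close>

lemma vec_eq_0_of_many_roots:
  fixes x :: "real vec"
  assumes x: "x \<in> carrier_vec n" and Z: "finite Z" "card Z = n"
    and zero: "\<And>z. z \<in> Z \<Longrightarrow> (\<Sum>j<n. complex_of_real (x $ j) * z ^ j) = 0"
  shows "x = 0\<^sub>v n"
\<comment> \<open>The degree bound \<open>n - 1\<close> is strictly below \<open>n\<close> only for
  positive \<open>n\<close>.\<close>
proof (cases "n = 0")
  case False
  define f where "f = (\<Sum>j<n. monom (complex_of_real (x $ j)) j)"
  have "degree f \<le> n - 1"
    unfolding f_def by (intro degree_sum_le) (auto intro: order_trans[OF degree_monom_le])
  then have "degree f < n"
    using False by linarith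
  then have "f = 0"
    using Z zero by (intro poly_eqI_degree[of Z]) (auto simp: f_def poly_sum poly_monom)
  then have "coeff f j = 0" for j
    by simp
  moreover have "coeff f j = complex_of_real (x $ j)" if "j < n" for j
    using that by (simp add: f_def coeff_sum)
  ultimately show ?thesis
    using x by (intro eq_vecI) auto
qed (use x in auto)

theorem signature_hermite_mat:
  assumes p: "p \<noteq> 0" "square_free_poly p"
  shows "signature (hermite_mat q p) =
    int (card {x. poly p x = 0 \<and> poly q x > 0}) - int (card {x. poly p x = 0 \<and> poly q x < 0})"
proof -
  let ?Z = "complex_root_set p" and ?Q = "poly (map_poly complex_of_real q)"
  define n where "n = length (root_enum p)"
  have fin: "finite ?Z" and card: "card ?Z = n"
    using finite_complex_root_set card_complex_root_set length_root_enum p by (auto simp: n_def)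
  text \<open>With \<open>w = \<Sum>j<n. x $ j * z ^ j\<close> and \<open>s\<^sup>2 = q z \<noteq> 0\<close>, a conjugate pair contributes
    \<open>q z * w\<^sup>2 + cnj (q z * w\<^sup>2) = 2 * (Re (s * w))\<^sup>2 - 2 * (Im (s * w))\<^sup>2\<close>; the two squares are
    attached to \<open>z\<close> and \<open>cnj z\<close>. If \<open>q z = 0\<close>, taking \<open>s = 1\<close> with coefficients \<open>0\<close> keeps the
    linear forms independent.\<close>
  define s where "s z = (if ?Q z = 0 then 1 else csqrt (?Q z))" for z
  define \<phi> :: "complex \<Rightarrow> complex \<Rightarrow> complex vec"
    where "\<phi> c z = vec n (\<lambda>j. c * z ^ j)" for c z
  define g where "g z = (if Im z = 0 then map_vec Re (\<phi> 1 z)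
      else if Im z > 0 then map_vec Re (\<phi> (s z) z) else map_vec Im (\<phi> (s (cnj z)) (cnj z)))" for z
  define d where "d z = (if Im z = 0 then Re (?Q z) else if ?Q z = 0 then 0 else if Im z > 0 then 2 else -2)"
    for z
  define f where "f x z = (\<Sum>j<n. complex_of_real (x $ j) * z ^ j)" for x z
  have \<phi>: "map_vec Re (\<phi> c z) \<bullet> x = Re (c * f x z)" "map_vec Im (\<phi> c z) \<bullet> x = Im (c * f x z)"
    if "x \<in> carrier_vec n" for c z x
  proof -
    have "c * f x z = (\<Sum>j<n. complex_of_real (x $ j) * (c * z ^ j))"
      by (simp add: f_def sum_distrib_left mult_ac)
    then show "map_vec Re (\<phi> c z) \<bullet> x = Re (c * f x z)" "map_vec Im (\<phi> c z) \<bullet> x = Im (c * f x z)"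
      using that by (simp_all add: \<phi>_def scalar_prod_def atLeast0LessThan mult.commute flip: scaleR_conv_of_real)
  qed
  have f_cnj: "f x (cnj z) = cnj (f x z)" for x z
    by (simp add: f_def)
  have sn: "s z \<noteq> 0" for z
    by (simp add: s_def)
  have form: "x \<bullet> (hermite_mat q p *\<^sub>v x) = (\<Sum>z \<in> ?Z. d z * (g z \<bullet> x)\<^sup>2)"
    if x: "x \<in> carrier_vec n" for x
  proof -
    have "(\<Sum>z \<in> ?Z. Re (?Q z * (f x z)\<^sup>2)) = (\<Sum>z \<in> ?Z. d z * (g z \<bullet> x)\<^sup>2)"
      unfolding sum_complex_root_set[OF p(1)]
    proof (rule arg_cong2[of _ _ _ _ "(+)"]; rule sum.cong[OF refl])
      fix z assume "z \<in> {z \<in> ?Z. Im z = 0}"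
      then have z: "cnj z = z" "Im z = 0"
        by (auto simp: complex_eq_iff)
      \<comment> \<open>At a real point, both values are fixed by conjugation.\<close>
      have "Im (?Q z) = 0" "Im (f x z) = 0"
        using poly_of_real_cnj[of q z] f_cnj[of x z] unfolding z(1) by (simp_all add: complex_eq_iff)
      then show "Re (?Q z * (f x z)\<^sup>2) = d z * (g z \<bullet> x)\<^sup>2"
        using z(2) x by (simp add: d_def g_def \<phi> power2_eq_square)
    next
      fix z assume "z \<in> {z \<in> ?Z. Im z > 0}"
      then have z: "Im z > 0"
        by simp
      have "Re (?Q z * (f x z)\<^sup>2) + Re (?Q (cnj z) * (f x (cnj z))\<^sup>2) = 2 * Re (?Q z * (f x z)\<^sup>2)"
        unfolding f_cnj poly_of_real_cnj by (simp flip: complex_cnj_power complex_cnj_mult)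
      also have "\<dots> = d z * (Re (s z * f x z))\<^sup>2 + d (cnj z) * (Im (s z * f x z))\<^sup>2"
      proof (cases "?Q z = 0")
        case True
        then show ?thesis
          using z unfolding d_def poly_of_real_cnj by simp
      next
        case False
        have "?Q z * (f x z)\<^sup>2 = (s z * f x z)\<^sup>2"
          using False by (simp add: s_def power_mult_distrib)
        then show ?thesis
          using False z unfolding d_def poly_of_real_cnj by (simp add: Re_power2)
      qed
      finally show "Re (?Q z * (f x z)\<^sup>2) + Re (?Q (cnj z) * (f x (cnj z))\<^sup>2)
          = d z * (g z \<bullet> x)\<^sup>2 + d (cnj z) * (g (cnj z) \<bullet> x)\<^sup>2"
        using z x by (simp add: g_def \<phi>)
    qed
    then show ?thesis
      using hermite_mat_quadratic_form[OF p(1) n_def x] by (simp add: f_def)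
  qed
  have inj: "x = 0\<^sub>v n" if x: "x \<in> carrier_vec n" and zero: "\<And>z. z \<in> ?Z \<Longrightarrow> g z \<bullet> x = 0" for x
  proof -
    \<comment> \<open>The forms attached to \<open>z\<close> and \<open>cnj z\<close> are the real
      and imaginary parts of \<open>s z * f x z\<close>, so together they determine
      \<open>f x z\<close>.\<close>
    have upper: "f x z = 0" if "z \<in> ?Z" "Im z > 0" for z
    proof -
      have "cnj z \<in> ?Z"
        using that by (simp add: cnj_complex_root_set_iff)
      then have "Re (s z * f x z) = 0" "Im (s z * f x z) = 0"
        using zero[OF that(1)] zero[of "cnj z"] that(2) x by (simp_all add: g_def \<phi>)
      then have "s z * f x z = 0"
        by (simp only: complex_eq_iff zero_complex.sel)
      then show ?thesis
        using sn by simp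
    qed
    have "f x z = 0" if "z \<in> ?Z" for z
    proof (cases "Im z" "0 :: real" rule: linorder_cases)
      case less
      then show ?thesis
        using upper[of "cnj z"] that by (simp add: cnj_complex_root_set_iff f_cnj)
    next
      case equal
      then have "cnj z = z"
        by (simp add: complex_eq_iff)
      then have "Im (f x z) = 0"
        using f_cnj[of x z] unfolding \<open>cnj z = z\<close> by (simp add: complex_eq_iff)
      then show ?thesis
        using zero[OF that] equal x by (simp add: g_def \<phi> complex_eq_iff)
    qed (use upper that in auto)
    then show ?thesis
      using vec_eq_0_of_many_roots[OF x fin card] by (simp add: f_def)
  qed
  \<comment> \<open>The predicate \<open>B\<close> stays arbitrary so that positive and negative
    values of \<open>q\<close> are treated alike.\<close>
  have real_roots: "card {z \<in> ?Z. Im z = 0 \<and> B (Re (?Q z))} = card {x. poly p x = 0 \<and> B (poly q x)}" for B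
  proof (rule bij_betw_same_card[of Re])
    have "{z \<in> ?Z. Im z = 0 \<and> B (Re (?Q z))} = complex_of_real ` {x. poly p x = 0 \<and> B (poly q x)}"
      by (auto simp: complex_root_set_def complex_is_Real_iff[symmetric] elim!: Reals_cases)
    then show "bij_betw Re {z \<in> ?Z. Im z = 0 \<and> B (Re (?Q z))} {x. poly p x = 0 \<and> B (poly q x)}"
      by (auto simp: bij_betw_def inj_on_def image_image)
  qed
  \<comment> \<open>Positive weights sit at real roots with \<open>q\<close> positive and at the
    upper member of each pair where \<open>q\<close> does not vanish; negative weights use the lower
    member. Conjugation matches the two nonreal families, so they cancel in the signature.\<close>
  have "{z \<in> ?Z. d z > 0} = {z \<in> ?Z. Im z = 0 \<and> Re (?Q z) > 0} \<union> {z \<in> ?Z. Im z > 0 \<and> ?Q z \<noteq> 0}"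
    by (auto simp: d_def split: if_splits)
  then have pos: "card {z \<in> ?Z. d z > 0}
      = card {x. poly p x = 0 \<and> poly q x > 0} + card {z \<in> ?Z. Im z > 0 \<and> ?Q z \<noteq> 0}"
    using fin real_roots[of "\<lambda>r. r > 0"] by (simp add: card_Un_disjoint disjoint_iff)
  have "{z \<in> ?Z. d z < 0} = {z \<in> ?Z. Im z = 0 \<and> Re (?Q z) < 0} \<union> {z \<in> ?Z. Im z < 0 \<and> ?Q z \<noteq> 0}"
    by (auto simp: d_def split: if_splits)
  then have neg: "card {z \<in> ?Z. d z < 0}
      = card {x. poly p x = 0 \<and> poly q x < 0} + card {z \<in> ?Z. Im z < 0 \<and> ?Q z \<noteq> 0}"
    using fin real_roots[of "\<lambda>r. r < 0"] by (simp add: card_Un_disjoint disjoint_iff)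
  have "bij_betw cnj {z \<in> ?Z. Im z > 0 \<and> ?Q z \<noteq> 0} {z \<in> ?Z. Im z < 0 \<and> ?Q z \<noteq> 0}"
    by (rule bij_betw_byWitness[of _ cnj]) (auto simp: cnj_complex_root_set_iff poly_of_real_cnj)
  then have pairs: "card {z \<in> ?Z. Im z > 0 \<and> ?Q z \<noteq> 0} = card {z \<in> ?Z. Im z < 0 \<and> ?Q z \<noteq> 0}"
    by (rule bij_betw_same_card)
  have "signature (hermite_mat q p) = int (card {z \<in> ?Z. d z > 0}) - int (card {z \<in> ?Z. d z < 0})"
  proof (rule signature_eq_of_quadratic_form[OF _ hermite_mat_symmetric[OF p(1)] fin card])
    show "hermite_mat q p \<in> carrier_mat n n"
      by (rule carrier_matI) (simp_all add: hermite_mat_def n_def)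
    show "g z \<in> carrier_vec n" for z
      by (simp add: g_def \<phi>_def)
  qed (use form inj in auto)
  then show ?thesis
    using pos neg pairs by simp
qed

section \<open>Exclusion of real eigenvalues from a Gershgorin disk\<close>

theorem corollary1:
  fixes A :: "real mat" and n i :: nat
  assumes "n \<ge> 1"
    and "A \<in> carrier_mat n n"
    and "square_free_poly (char_poly A)"
    and "i < n"
    and "signature (hermite_mat (gershgorin_poly A i) (char_poly A))
         = signature (hermite_mat 1 (char_poly A))"
  shows "\<not> (\<exists>x::real. eigenvalue A x \<and> complex_of_real x \<in> gershgorin_disk A i)"
proof
  let ?p = "char_poly A" and ?q = "gershgorin_poly A i"
  assume "\<exists>x::real. eigenvalue A x \<and> complex_of_real x \<in> gershgorin_disk A i"
  then obtain x where x: "eigenvalue A x" "complex_of_real x \<in> gershgorin_disk A i"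
    by blast
  have p: "?p \<noteq> 0"
    using degree_monic_char_poly[OF assms(2)] by auto
  have fin: "finite {y. poly ?p y = 0}"
    by (rule poly_roots_finite[OF p])
  have root: "poly ?p x = 0"
    using x(1) eigenvalue_root_char_poly[OF assms(2)] by simp
  have "\<bar>x - A $$ (i, i)\<bar> \<le> gershgorin_radius A i"
    using x(2) unfolding gershgorin_disk_def by (simp flip: of_real_diff)
  then have "(x - A $$ (i, i))\<^sup>2 \<le> (gershgorin_radius A i)\<^sup>2"
    using power_mono[of "\<bar>x - A $$ (i, i)\<bar>" _ 2] by simp
  then have nonpos: "poly ?q x \<le> 0"
    by (simp add: gershgorin_poly_def)
  \<comment> \<open>The signature for \<open>1\<close> counts all real roots. The signature for
    \<open>?q\<close> is at most the number of those with \<open>?q\<close> positive, which omits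
    \<open>x\<close> and is therefore strictly smaller.\<close>
  have "card {y. poly ?p y = 0 \<and> poly ?q y > 0} < card {y. poly ?p y = 0}"
    using fin root nonpos by (intro psubset_card_mono) (auto simp: not_less[symmetric])
  then show False
    using assms(5) unfolding signature_hermite_mat[OF p assms(3)] by simp
qed

end
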